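(* Let $n\ge 2$ and let $f$ be a Möbius transformation with $f(\mathbb{H}^n)=\mathbb{B}^n$. Then for all $x,y\in\mathbb{H}^n$, $$u_{\mathbb{H}^n}(x,y)-2\log 2\le u_{\mathbb{B}^n}(f(x),f(y))\le u_{\mathbb{H}^n}(x,y)+2\log 2,$$ and the left-hand inequality is sharp, i.e. in it the constant $2\log 2$ cannot be replaced by a smaller constant so that it holds for all such $f$ and all $x,y\in\mathbb{H}^n$.
   Context: $\overline{\mathbb{R}}^n=\mathbb{R}^n\cup\{\infty\}$; a Möbius transformation of $\overline{\mathbb{R}}^n$ is a finite composition of reflections (inversions) in spheres and hyperplanes. $\mathbb{B}^n=\{z\in\mathbb{R}^n:|z|<1\}$ and $\mathbb{H}^n=\{x=(x_1,\dots,x_n)\in\mathbb{R}^n:x_n>0\}$. For a domain $D\subsetneq\mathbb{R}^n$ and $x\in D$, $d(x)$ denotes the Euclidean distance from $x$ to the boundary of $D$ in $\mathbb{R}^n$, and the Gromov hyperbolic metric $u_D$ is $$u_D(x,y)=2\log\frac{|x-y|+\max\{d(x),d(y)\}}{\sqrt{d(x)\,d(y)}},\qquad x,y\in D.$$ Thus $d(x)=1-|x|$ for $D=\mathbb{B}^n$ and $d(x)=x_n$ for $D=\mathbb{H}^n$. *)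

theory Defs
  imports "HOL-Analysis.Analysis"
begin

(* The one-point compactification of a Euclidean space is modelled by the option type
   (as in Alexandroff_compactification): None is the point at infinity. *)

fun sphere_reflection ::
  "'a::euclidean_space \<Rightarrow> real \<Rightarrow> 'a option \<Rightarrow> 'a option" where
  "sphere_reflection a r None = Some a"
| "sphere_reflection a r (Some x) =
     (if x = a then None else Some (a + (r / norm (x - a))\<^sup>2 *\<^sub>R (x - a)))"

(* Reflection in the hyperplane {x. a \<bullet> x = t}, where a is a nonzero normal vector. *)
fun hyperplane_reflection ::
  "'a::euclidean_space \<Rightarrow> real \<Rightarrow> 'a option \<Rightarrow> 'a option" where
  "hyperplane_reflection a t None = None"
| "hyperplane_reflection a t (Some x) =
     Some (x - (2 * (a \<bullet> x - t) / (norm a)\<^sup>2) *\<^sub>R a)"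

(* The base case adds no map: the identity is the square of any reflection. *)
inductive moebius_transformation :: "('a::euclidean_space option \<Rightarrow> 'a option) \<Rightarrow> bool" where
  id: "moebius_transformation id"
| sphere: "r > 0 \<Longrightarrow> moebius_transformation f \<Longrightarrow>
    moebius_transformation (sphere_reflection a r \<circ> f)"
| hyperplane: "a \<noteq> 0 \<Longrightarrow> moebius_transformation f \<Longrightarrow>
    moebius_transformation (hyperplane_reflection a t \<circ> f)"

definition boundary_dist :: "'a::euclidean_space set \<Rightarrow> 'a \<Rightarrow> real" where
  "boundary_dist D x = infdist x (frontier D)"

definition gromov_metric :: "'a::euclidean_space set \<Rightarrow> 'a \<Rightarrow> 'a \<Rightarrow> real" where
  "gromov_metric D x y =
     2 * ln ((norm (x - y) + max (boundary_dist D x) (boundary_dist D y)) /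
             sqrt (boundary_dist D x * boundary_dist D y))"

(* A finite index type carries no order, so the distinguished ("last") coordinate is an
   explicit parameter k. *)
definition upper_half_space :: "'n::finite \<Rightarrow> (real ^ 'n) set" where
  "upper_half_space k = {x. x $ k > 0}"

definition half_space_to_ball ::
  "'n::finite \<Rightarrow> ((real ^ 'n) option \<Rightarrow> (real ^ 'n) option) \<Rightarrow> bool" where
  "half_space_to_ball k f \<longleftrightarrow>
     moebius_transformation f \<and> f ` Some ` upper_half_space k = Some ` ball 0 1"

end

theory Submission
  imports Defs
begin

text \<open>
  Both metrics are compared with the hyperbolic distance \<open>\<rho>\<close>, which every Moebius map of the half-space
  onto the ball preserves. Put \<open>s = sinh (\<rho> / 2)\<close>, so that \<open>exp (\<rho> / 2) = s + sqrt (s\<^sup>2 + 1)\<close>, and write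
  \<open>E_H\<close> and \<open>E_B\<close> for the quotients inside the logarithms of the two Gromov metrics. In the half-space
  \<open>E_H = 2 * s + sqrt (h / l)\<close> with \<open>h \<ge> l\<close> the heights of the two points, and \<open>\<rho>\<close> is at least the
  logarithm of \<open>h / l\<close>; hence \<open>2 * s + 1 \<le> E_H \<le> 3 * s + sqrt (s\<^sup>2 + 1)\<close>
  (\<open>half_space_quotient_bounds\<close>). In the ball elementary estimates
  in the two moduli and the distance give \<open>3 * s + sqrt (s\<^sup>2 + 1) \<le> 2 * E_B\<close> and
  \<open>E_B \<le> 2 * (2 * s + 1)\<close> (\<open>ball_quotient_bounds\<close>). Thus \<open>E_H\<close> and \<open>E_B\<close> differ at most by a factor 2.

  The invariance of \<open>s\<close> is \<open>half_space_to_ball_sinh_invariant\<close>. A Moebius map acts on the null cone of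
  Lorentz space by a linear isometry, and a round ball or a half-space is the set of points whose null
  vectors have positive product with a fixed vector. The isometry has to match the vector of the
  half-space with that of the ball, which says that heights \<open>2 * x $ k\<close> and the values
  \<open>1 - (norm x')\<^sup>2\<close> correspond up to the same conformal factor that relates Euclidean distances.

  For sharpness, \<open>E_H\<close> should be near \<open>exp (\<rho> / 2) + 2 * s\<close>, so the two points lie on a vertical line,
  and \<open>E_B\<close> near \<open>2 * s\<close>, so their images have equal modulus close to 1. The points at heights \<open>a\<close> and
  \<open>1 / a\<close> on the axis of the Cayley transform do this: there \<open>E_H = 2 * a - 1 / a\<close> and \<open>E_B = a\<close>, and
  the quotient tends to 2 as \<open>a\<close> grows.
\<close>

section \<open>Lorentz lifts of Moebius transformations\<close>

text \<open>
  In light-cone coordinates \<open>(p, v, q)\<close> this is the form of signature \<open>(n + 1, 1)\<close> whose quadratic form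
  is \<open>v \<bullet> v - p * q\<close>.
\<close>

fun lorentz_form :: "real \<times> 'a::euclidean_space \<times> real \<Rightarrow> real \<times> 'a \<times> real \<Rightarrow> real" where
  "lorentz_form (p, v, q) (p', v', q') = v \<bullet> v' - (p * q' + p' * q) / 2"

text \<open>
  Each point of the compactified space is a ray of the light cone; this picks the representative whose
  first coordinate is 1, and for the point at infinity the remaining ray.
\<close>

fun null_vector :: "'a::euclidean_space option \<Rightarrow> real \<times> 'a \<times> real" where
  "null_vector None = (0, 0, 1)"
| "null_vector (Some x) = (1, x, x \<bullet> x)"

lemma lorentz_form_commute: "lorentz_form u v = lorentz_form v u"
  by (cases u; cases v) (auto simp: inner_commute algebra_simps)

lemma lorentz_form_diff_left: "lorentz_form (u - v) w = lorentz_form u w - lorentz_form v w"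
  by (cases u; cases v; cases w) (auto simp: inner_diff_left field_simps)

lemma lorentz_form_scaleR_left: "lorentz_form (c *\<^sub>R u) w = c * lorentz_form u w"
  by (cases u; cases w) (auto simp: field_simps)

lemma lorentz_form_diff_right: "lorentz_form w (u - v) = lorentz_form w u - lorentz_form w v"
  by (simp add: lorentz_form_commute[of w] lorentz_form_diff_left)

lemma lorentz_form_scaleR_right: "lorentz_form w (c *\<^sub>R u) = c * lorentz_form w u"
  by (simp add: lorentz_form_commute[of w] lorentz_form_scaleR_left)

lemmas lorentz_form_linear =
  lorentz_form_diff_left lorentz_form_diff_right lorentz_form_scaleR_left lorentz_form_scaleR_right

lemma lorentz_form_null_vectors:
  "lorentz_form (null_vector (Some x)) (null_vector (Some y)) = - (norm (x - y))\<^sup>2 / 2"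
  by (simp add: power2_norm_eq_inner inner_diff inner_commute field_simps)

lemma lorentz_form_null_vector_self: "lorentz_form (null_vector z) (null_vector z) = 0"
  by (cases z) auto

text \<open>Orthogonal null vectors are proportional; this is what makes maps with a lift injective.\<close>

lemma lorentz_form_null_vector_eq_0:
  "lorentz_form (null_vector z) (null_vector w) = 0 \<Longrightarrow> z = w"
proof (cases z; cases w)
  fix x y assume "z = Some x" "w = Some y" "lorentz_form (null_vector z) (null_vector w) = 0"
  then show "z = w"
    using lorentz_form_null_vectors[of x y] by (simp del: null_vector.simps)
qed auto

text \<open>
  This says that \<open>null_vector z \<mapsto> \<mu> z *\<^sub>R null_vector (f z)\<close> is the restriction of a linear Lorentz isometry.
  The isometry itself is not mentioned: the clauses record that it preserves products and that it has an
  adjoint \<open>e \<mapsto> e'\<close>, which is again an isometry. Positivity of \<open>\<mu>\<close> means that the two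
  halves of the light cone are not exchanged.
\<close>

definition lorentz_lift ::
    "('a::euclidean_space option \<Rightarrow> 'a option) \<Rightarrow> ('a option \<Rightarrow> real) \<Rightarrow> bool" where
  "lorentz_lift f \<mu> \<longleftrightarrow> (\<forall>z. \<mu> z > 0) \<and>
     (\<forall>z w. lorentz_form (null_vector z) (null_vector w) =
        \<mu> z * \<mu> w * lorentz_form (null_vector (f z)) (null_vector (f w))) \<and>
     (\<forall>e. \<exists>e'. lorentz_form e' e' = lorentz_form e e \<and>
        (\<forall>z. lorentz_form (null_vector z) e' = \<mu> z * lorentz_form (null_vector (f z)) e))"

lemma lorentz_lift_pos: "lorentz_lift f \<mu> \<Longrightarrow> \<mu> z > 0"
  by (simp add: lorentz_lift_def)

lemma lorentz_lift_form:
  "lorentz_lift f \<mu> \<Longrightarrow> lorentz_form (null_vector z) (null_vector w) =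
     \<mu> z * \<mu> w * lorentz_form (null_vector (f z)) (null_vector (f w))"
  unfolding lorentz_lift_def by (elim conjE) (drule spec, drule spec, assumption)

lemma lorentz_lift_adjoint:
  assumes "lorentz_lift f \<mu>"
  obtains e' where "lorentz_form e' e' = lorentz_form e e"
    "\<forall>z. lorentz_form (null_vector z) e' = \<mu> z * lorentz_form (null_vector (f z)) e"
proof -
  have "\<exists>e'. lorentz_form e' e' = lorentz_form e e \<and>
      (\<forall>z. lorentz_form (null_vector z) e' = \<mu> z * lorentz_form (null_vector (f z)) e)"
    using assms unfolding lorentz_lift_def by (elim conjE) (erule spec)
  then show thesis by (elim exE conjE) (rule that)
qed

lemma lorentz_lift_id: "lorentz_lift id (\<lambda>_. 1)"
  by (auto simp: lorentz_lift_def)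

lemma lorentz_lift_comp:
  assumes g: "lorentz_lift g \<nu>" and f: "lorentz_lift f \<mu>"
  shows "lorentz_lift (g \<circ> f) (\<lambda>z. \<mu> z * \<nu> (f z))"
  unfolding lorentz_lift_def
proof (intro conjI allI)
  show "\<mu> z * \<nu> (f z) > 0" for z
    using lorentz_lift_pos[OF f] lorentz_lift_pos[OF g] by simp
  show "lorentz_form (null_vector z) (null_vector w) = \<mu> z * \<nu> (f z) * (\<mu> w * \<nu> (f w)) *
      lorentz_form (null_vector ((g \<circ> f) z)) (null_vector ((g \<circ> f) w))" for z w
    unfolding lorentz_lift_form[OF f, of z w] lorentz_lift_form[OF g, of "f z" "f w"] by simp
  fix e
  obtain e1 where e1: "lorentz_form e1 e1 = lorentz_form e e"
    "\<forall>z. lorentz_form (null_vector z) e1 = \<nu> z * lorentz_form (null_vector (g z)) e"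
    using lorentz_lift_adjoint[OF g, of e] .
  obtain e2 where e2: "lorentz_form e2 e2 = lorentz_form e1 e1"
    "\<forall>z. lorentz_form (null_vector z) e2 = \<mu> z * lorentz_form (null_vector (f z)) e1"
    using lorentz_lift_adjoint[OF f, of e1] .
  show "\<exists>e'. lorentz_form e' e' = lorentz_form e e \<and> (\<forall>z. lorentz_form (null_vector z) e' =
      \<mu> z * \<nu> (f z) * lorentz_form (null_vector ((g \<circ> f) z)) e)"
    by (rule exI[of _ e2]) (simp add: e1(1) e2(1) e1(2)[rule_format] e2(2)[rule_format])
qed

definition lorentz_reflection ::
    "real \<times> 'a::euclidean_space \<times> real \<Rightarrow> real \<times> 'a \<times> real \<Rightarrow> real \<times> 'a \<times> real" where
  "lorentz_reflection n u = u - (2 * lorentz_form u n) *\<^sub>R n"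

lemma lorentz_reflection_self_adjoint:
  "lorentz_form u (lorentz_reflection n v) = lorentz_form (lorentz_reflection n u) v"
  unfolding lorentz_reflection_def lorentz_form_linear lorentz_form_commute[of n v] by simp

lemma lorentz_reflection_involution:
  assumes "lorentz_form n n = 1"
  shows "lorentz_reflection n (lorentz_reflection n u) = u"
  unfolding lorentz_reflection_def lorentz_form_linear assms by simp

lemma lorentz_reflection_isometry:
  assumes "lorentz_form n n = 1"
  shows "lorentz_form (lorentz_reflection n u) (lorentz_reflection n v) = lorentz_form u v"
  unfolding lorentz_reflection_self_adjoint lorentz_reflection_involution[OF assms] ..

text \<open>
  Spheres and hyperplanes correspond to unit spacelike vectors \<open>n\<close>, and the inversion in one of them to
  the orthogonal reflection along \<open>n\<close>. As such a reflection is a self-adjoint isometry, it only has to be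
  compared with \<open>f\<close> on null vectors.
\<close>

lemma lorentz_lift_reflection:
  assumes n: "lorentz_form n n = 1" and pos: "\<And>z. \<mu> z > 0"
    and lift: "\<And>z. lorentz_reflection n (null_vector z) = \<mu> z *\<^sub>R null_vector (f z)"
  shows "lorentz_lift f \<mu>"
  unfolding lorentz_lift_def
proof (intro conjI allI)
  show "\<mu> z > 0" for z by (rule pos)
  show "lorentz_form (null_vector z) (null_vector w) =
      \<mu> z * \<mu> w * lorentz_form (null_vector (f z)) (null_vector (f w))" for z w
    unfolding lorentz_reflection_isometry[OF n, of "null_vector z" "null_vector w", symmetric]
    by (simp add: lift lorentz_form_linear)
  show "\<exists>e'. lorentz_form e' e' = lorentz_form e e \<and>
      (\<forall>z. lorentz_form (null_vector z) e' = \<mu> z * lorentz_form (null_vector (f z)) e)" for e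
  proof (intro exI[of _ "lorentz_reflection n e"] conjI allI)
    show "lorentz_form (lorentz_reflection n e) (lorentz_reflection n e) = lorentz_form e e"
      by (rule lorentz_reflection_isometry[OF n])
    show "lorentz_form (null_vector z) (lorentz_reflection n e) =
        \<mu> z * lorentz_form (null_vector (f z)) e" for z
      by (simp only: lorentz_reflection_self_adjoint lift lorentz_form_scaleR_left)
  qed
qed

text \<open>
  The vector \<open>n\<close> is normalised so that \<open>2 * r * lorentz_form (null_vector (Some x)) n\<close> is the power
  \<open>r\<^sup>2 - (norm (x - a))\<^sup>2\<close> with respect to the sphere; at finite points other than the centre this makes
  \<open>\<mu>\<close> the reciprocal of the factor by which the inversion scales vectors from the centre. The
  exchange of the centre and infinity gives the other two values.
\<close>

lemma lorentz_lift_sphere_reflection: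
  fixes a :: "'a::euclidean_space"
  assumes r: "r > 0"
  obtains \<mu> where "lorentz_lift (sphere_reflection a r) \<mu>"
proof (rule that, rule lorentz_lift_reflection)
  let ?n = "(1 / r) *\<^sub>R (1, a, a \<bullet> a - r\<^sup>2)"
  let ?\<mu> = "\<lambda>z. case z of None \<Rightarrow> 1 / r\<^sup>2
      | Some x \<Rightarrow> if x = a then r\<^sup>2 else (norm (x - a))\<^sup>2 / r\<^sup>2"
  show "lorentz_form ?n ?n = 1"
    using r by (simp add: field_simps power2_eq_square)
  show "?\<mu> z > 0" for z
    using r by (auto split: option.splits)
  show "lorentz_reflection ?n (null_vector z) = ?\<mu> z *\<^sub>R null_vector (sphere_reflection a r z)" for z
  proof (cases z)
    case None
    then show ?thesis
      using r by (simp add: lorentz_reflection_def power2_eq_square field_simps)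
  next
    case (Some x)
    define d where "d = (norm (x - a))\<^sup>2"
    have d: "d = x \<bullet> x - 2 * (x \<bullet> a) + a \<bullet> a"
      by (simp add: d_def power2_norm_eq_inner inner_diff inner_commute)
    have form: "2 * lorentz_form (null_vector z) ?n = (r\<^sup>2 - d) / r"
      using r by (simp add: Some d field_simps)
    have refl: "lorentz_reflection ?n (null_vector z) =
        (1 - (r\<^sup>2 - d) / r\<^sup>2, x - ((r\<^sup>2 - d) / r\<^sup>2) *\<^sub>R a, x \<bullet> x - (r\<^sup>2 - d) / r\<^sup>2 * (a \<bullet> a - r\<^sup>2))"
      unfolding lorentz_reflection_def form by (simp add: Some power2_eq_square)
    show ?thesis
    proof (cases "x = a")
      case True
      then show ?thesis unfolding refl using r by (simp add: Some d)
    next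
      case False
      then have "d > 0" by (simp add: d_def)
      define y where "y = a + (r / norm (x - a))\<^sup>2 *\<^sub>R (x - a)"
      have y: "y = a + (r\<^sup>2 / d) *\<^sub>R (x - a)"
        by (simp add: y_def d_def power_divide)
      have "(d / r\<^sup>2) *\<^sub>R y = (d / r\<^sup>2) *\<^sub>R a + (x - a)"
        using r \<open>d > 0\<close> by (simp add: y scaleR_add_right)
      then have 1: "x - ((r\<^sup>2 - d) / r\<^sup>2) *\<^sub>R a = (d / r\<^sup>2) *\<^sub>R y"
        using r by (simp add: diff_divide_distrib algebra_simps)
      define \<kappa> where "\<kappa> = d / r\<^sup>2"
      have \<kappa>: "\<kappa> * r\<^sup>2 = d" "(r\<^sup>2 - d) / r\<^sup>2 = 1 - \<kappa>" "r\<^sup>2 / d = 1 / \<kappa>" "\<kappa> > 0"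
        using r \<open>d > 0\<close> by (auto simp: \<kappa>_def field_simps)
      have "\<kappa> *\<^sub>R y = \<kappa> *\<^sub>R a + (x - a)"
        using \<kappa>(4) by (simp add: y \<kappa>(3) scaleR_add_right)
      then have "\<kappa> * (\<kappa> * (y \<bullet> y)) = (\<kappa> *\<^sub>R a + (x - a)) \<bullet> (\<kappa> *\<^sub>R a + (x - a))"
        by (metis inner_scaleR_left inner_scaleR_right)
      also have "\<dots> = \<kappa> * (\<kappa> * (a \<bullet> a) + 2 * (x \<bullet> a) - 2 * (a \<bullet> a)) + (x - a) \<bullet> (x - a)"
        by (simp add: inner_add inner_diff inner_commute algebra_simps)
      also have "(x - a) \<bullet> (x - a) = \<kappa> * r\<^sup>2"
        unfolding \<kappa>(1) by (simp add: d_def power2_norm_eq_inner)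
      finally have "\<kappa> * (\<kappa> * (y \<bullet> y)) =
          \<kappa> * (\<kappa> * (a \<bullet> a) + 2 * (x \<bullet> a) - 2 * (a \<bullet> a) + r\<^sup>2)"
        by (simp add: distrib_left)
      then have "\<kappa> * (y \<bullet> y) = \<kappa> * (a \<bullet> a) + 2 * (x \<bullet> a) - 2 * (a \<bullet> a) + r\<^sup>2"
        using \<kappa>(4) by simp
      also have "\<dots> = x \<bullet> x - (1 - \<kappa>) * (a \<bullet> a - r\<^sup>2)"
        using \<kappa>(1) d by (simp add: algebra_simps)
      finally have 2: "x \<bullet> x - (r\<^sup>2 - d) / r\<^sup>2 * (a \<bullet> a - r\<^sup>2) = (d / r\<^sup>2) * (y \<bullet> y)"
        unfolding \<kappa>(2) \<kappa>_def[symmetric] by (rule sym)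
      have "1 - (r\<^sup>2 - d) / r\<^sup>2 = d / r\<^sup>2"
        using r by (simp add: field_simps)
      with 1 2 show ?thesis
        unfolding refl using False by (simp add: Some y_def[symmetric] d_def[symmetric])
    qed
  qed
qed

text \<open>Euclidean isometries preserve the normalisation of the null vectors, so here \<open>\<mu>\<close> is 1.\<close>

lemma lorentz_lift_hyperplane_reflection:
  fixes a :: "'a::euclidean_space"
  assumes a: "a \<noteq> 0"
  obtains \<mu> where "lorentz_lift (hyperplane_reflection a t) \<mu>"
proof (rule that, rule lorentz_lift_reflection)
  let ?n = "(1 / norm a) *\<^sub>R (0, a, 2 * t)"
  show "lorentz_form ?n ?n = 1"
    using a by (simp add: field_simps power2_norm_eq_inner[symmetric] power2_eq_square)
  show "(1::real) > 0" by simp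
  show "lorentz_reflection ?n (null_vector z) = 1 *\<^sub>R null_vector (hyperplane_reflection a t z)" for z
  proof (cases z)
    case None
    then show ?thesis by (simp add: lorentz_reflection_def zero_prod_def)
  next
    case (Some x)
    define c where "c = 2 * (a \<bullet> x - t) / (norm a)\<^sup>2"
    have form: "2 * lorentz_form (null_vector z) ?n = 2 * (a \<bullet> x - t) / norm a"
      using a by (simp add: Some inner_commute field_simps)
    have "lorentz_reflection ?n (null_vector z) = (1, x - c *\<^sub>R a, x \<bullet> x - c * (2 * t))"
      unfolding lorentz_reflection_def form by (simp add: Some c_def power2_eq_square)
    moreover have "c * (a \<bullet> a) = 2 * (a \<bullet> x - t)"
      using a by (simp add: c_def power2_norm_eq_inner[symmetric])
    then have "c * (c * (a \<bullet> a)) = c * (2 * (a \<bullet> x - t))"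
      by (simp only:)
    then have "(x - c *\<^sub>R a) \<bullet> (x - c *\<^sub>R a) = x \<bullet> x - c * (2 * t)"
      by (simp add: inner_diff inner_commute algebra_simps)
    moreover have "hyperplane_reflection a t z = Some (x - c *\<^sub>R a)"
      by (simp add: Some c_def)
    ultimately show ?thesis by simp
  qed
qed

lemma moebius_transformation_lorentz_lift:
  "moebius_transformation f \<Longrightarrow> \<exists>\<mu>. lorentz_lift f \<mu>"
proof (induction rule: moebius_transformation.induct)
  case id
  show ?case by (rule exI, rule lorentz_lift_id)
next
  case (sphere r f a)
  then show ?case by (metis lorentz_lift_comp lorentz_lift_sphere_reflection)
next
  case (hyperplane a f t)
  then show ?case by (metis lorentz_lift_comp lorentz_lift_hyperplane_reflection)
qed

section \<open>Invariance of the hyperbolic distance\<close>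

text \<open>
  The function \<open>x \<mapsto> lorentz_form (null_vector (Some x)) (p, v, q)\<close> is a quadratic polynomial with quadratic
  part a multiple of \<open>x \<bullet> x\<close>. If it is positive exactly on the half-space, it vanishes on the boundary
  hyperplane by continuity. Evaluating it at 0 and at \<open>\<plusminus>\<close> a unit vector in that hyperplane, which
  exists from dimension 2 on, leaves a multiple of \<open>x $ k\<close>.
\<close>

lemma lorentz_vector_of_half_space:
  fixes k :: "'n::finite" and v :: "real ^ 'n"
  assumes card: "CARD('n) \<ge> 2"
    and pos: "\<And>x. x \<in> upper_half_space k \<Longrightarrow> lorentz_form (null_vector (Some x)) (p, v, q) > 0"
    and nonpos: "\<And>x. x \<notin> upper_half_space k \<Longrightarrow> lorentz_form (null_vector (Some x)) (p, v, q) \<le> 0"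
    and unit: "lorentz_form (p, v, q) (p, v, q) = 4"
  shows "(p, v, q) = (0, axis k 2, 0)"
proof -
  define Q where "Q x = lorentz_form (null_vector (Some x)) (p, v, q)" for x
  have Q: "Q x = x \<bullet> v - (q + p * (x \<bullet> x)) / 2" for x
    by (simp add: Q_def)
  have bdry: "Q w = 0" if w: "w $ k = 0" for w
  proof -
    have "((\<lambda>t. Q (w + t *\<^sub>R axis k 1)) \<longlongrightarrow> Q (w + 0 *\<^sub>R axis k 1)) (at_right 0)"
      unfolding Q by (intro tendsto_intros) auto
    moreover have "\<forall>\<^sub>F t in at_right 0. Q (w + t *\<^sub>R axis k 1) \<ge> 0"
      using eventually_at_right_less[of "0::real"]
    proof eventually_elim
      case (elim t)
      then have "w + t *\<^sub>R axis k 1 \<in> upper_half_space k"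
        using w by (simp add: upper_half_space_def)
      then show ?case using pos Q_def by fastforce
    qed
    ultimately have "Q (w + 0 *\<^sub>R axis k 1) \<ge> 0"
      by (intro tendsto_lowerbound[of _ _ "at_right 0"]) auto
    moreover have "Q w \<le> 0"
      using nonpos[of w] w by (simp add: Q_def upper_half_space_def)
    ultimately show ?thesis by simp
  qed
  have q: "q = 0"
    using bdry[of 0] by (simp add: Q)
  obtain j where j: "j \<noteq> k"
  proof -
    have "UNIV \<noteq> {k}"
    proof
      assume "UNIV = {k}"
      then have "CARD('n) = 1" by (metis card_1_singleton_iff One_nat_def)
      with card show False by simp
    qed
    with that show thesis by blast
  qed
  have "Q (axis j 1) = 0" "Q (- axis j 1) = 0"
    using j by (auto intro!: bdry simp: axis_def)
  then have p: "p = 0"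
    by (simp add: Q q inner_axis_axis)
  have "v $ i = 0" if "i \<noteq> k" for i
  proof -
    have "Q (axis i 1) = 0"
      using that by (intro bdry) (simp add: axis_def)
    then show ?thesis by (simp add: Q p q inner_axis')
  qed
  then have v: "v = axis k (v $ k)"
    by (auto simp: vec_eq_iff axis_def)
  have "(v $ k)\<^sup>2 = 2\<^sup>2"
  proof -
    have "v \<bullet> v = (v $ k)\<^sup>2"
      using inner_axis[of v k "v $ k"] v by (simp add: power2_eq_square)
    with unit show ?thesis by (simp add: p q)
  qed
  moreover have "v $ k > 0"
    using pos[of "axis k 1"] by (simp add: upper_half_space_def p q inner_axis')
  ultimately have "v $ k = 2"
    unfolding power2_eq_iff by auto
  with v p q show ?thesis by simp
qed

text \<open>
  The equation says that \<open>sinh\<^sup>2 (\<rho> / 2)\<close>, which is \<open>(norm (x - y))\<^sup>2 / (4 * x $ k * y $ k)\<close> in the half-space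
  and \<open>(norm (x' - y'))\<^sup>2 / ((1 - (norm x')\<^sup>2) * (1 - (norm y')\<^sup>2))\<close> in the ball, is preserved. Pulling the
  vector \<open>b\<close> of the unit ball back by the adjoint of the lift yields the vector of the half-space, so
  both sides acquire the same conformal factors.
\<close>

lemma half_space_to_ball_sinh_invariant:
  fixes k :: "'n::finite" and x y :: "real ^ 'n"
  assumes card: "CARD('n) \<ge> 2" and f: "half_space_to_ball k f"
    and x: "x \<in> upper_half_space k" and y: "y \<in> upper_half_space k"
  obtains x' y' where "f (Some x) = Some x'" "f (Some y) = Some y'" "norm x' < 1" "norm y' < 1"
    "(norm (x - y))\<^sup>2 * ((1 - (norm x')\<^sup>2) * (1 - (norm y')\<^sup>2)) =
     4 * (x $ k * y $ k) * (norm (x' - y'))\<^sup>2"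
proof -
  have "moebius_transformation f" and img: "f ` Some ` upper_half_space k = Some ` ball 0 1"
    using f unfolding half_space_to_ball_def by (rule conjunct1, rule conjunct2)
  then obtain \<mu> where lift: "lorentz_lift f \<mu>"
    using moebius_transformation_lorentz_lift[of f] by blast
  note pos = lorentz_lift_pos[OF lift] and form = lorentz_lift_form[OF lift]
  define b :: "real \<times> (real ^ 'n) \<times> real" where "b = (2, 0, -2)"
  have b_Some: "lorentz_form (null_vector (Some u)) b = 1 - (norm u)\<^sup>2" for u
    by (simp add: b_def power2_norm_eq_inner field_simps)
  have b_None: "lorentz_form (null_vector None) b = -1"
    by (simp add: b_def)
  obtain e' where e': "lorentz_form e' e' = lorentz_form b b"
    "\<forall>z. lorentz_form (null_vector z) e' = \<mu> z * lorentz_form (null_vector (f z)) b"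
    using lorentz_lift_adjoint[OF lift, of b] .
  obtain p v q where pvq: "e' = (p, v, q)"
    by (cases e')
  have unit: "lorentz_form (p, v, q) (p, v, q) = 4"
    using e'(1) unfolding pvq by (simp add: b_def)
  note e = e'(2)[unfolded pvq, rule_format]
  \<comment> \<open>Injectivity is needed so that points outside the half-space are mapped outside the ball.\<close>
  have inj: "z = w" if "f z = f w" for z w
  proof (rule lorentz_form_null_vector_eq_0)
    show "lorentz_form (null_vector z) (null_vector w) = 0"
      unfolding form[of z w] that lorentz_form_null_vector_self by simp
  qed
  have "(p, v, q) = (0, axis k 2, 0)"
  proof (rule lorentz_vector_of_half_space[OF card _ _ unit])
    fix u assume "u \<in> upper_half_space k"
    then have "f (Some u) \<in> Some ` ball 0 1"
      unfolding img[symmetric] by (intro imageI)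
    then obtain u' where u': "f (Some u) = Some u'" "norm u' < 1"
      by (auto simp: image_iff)
    then have "1 - (norm u')\<^sup>2 > 0"
      by (simp add: abs_square_less_1)
    then show "lorentz_form (null_vector (Some u)) (p, v, q) > 0"
      unfolding e[of "Some u"] u'(1) b_Some by (rule mult_pos_pos[OF pos])
  next
    fix u assume u: "u \<notin> upper_half_space k"
    have outside: "f (Some u) \<notin> Some ` ball 0 1"
    proof
      assume "f (Some u) \<in> Some ` ball 0 1"
      then obtain w where w: "w \<in> upper_half_space k" "f (Some u) = f (Some w)"
        unfolding img[symmetric] by (elim imageE) simp
      from inj[OF w(2)] w(1) u show False by simp
    qed
    have "lorentz_form (null_vector (f (Some u))) b \<le> 0"
    proof (cases "f (Some u)")
      case None
      show ?thesis unfolding None b_None by simp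
    next
      case (Some y)
      then have "1 \<le> norm y"
        using outside by auto
      then show ?thesis unfolding Some b_Some by simp
    qed
    then show "lorentz_form (null_vector (Some u)) (p, v, q) \<le> 0"
      unfolding e[of "Some u"] by (intro mult_nonneg_nonpos less_imp_le[OF pos])
  qed
  then have height: "2 * u $ k = \<mu> (Some u) * lorentz_form (null_vector (f (Some u))) b" for u
    using e[of "Some u"] by (simp add: inner_axis)
  have "f (Some x) \<in> Some ` ball 0 1" "f (Some y) \<in> Some ` ball 0 1"
    using img x y by blast+
  then obtain x' y' where x': "f (Some x) = Some x'" "norm x' < 1"
    and y': "f (Some y) = Some y'" "norm y' < 1"
    by auto
  have "2 * x $ k = \<mu> (Some x) * (1 - (norm x')\<^sup>2)" "2 * y $ k = \<mu> (Some y) * (1 - (norm y')\<^sup>2)"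
    using height[of x] height[of y] by (simp_all only: x' y' b_Some)
  then have "2 * x $ k * (2 * y $ k) =
      \<mu> (Some x) * (1 - (norm x')\<^sup>2) * (\<mu> (Some y) * (1 - (norm y')\<^sup>2))"
    by (simp only:)
  then have "4 * (x $ k * y $ k) =
      \<mu> (Some x) * (1 - (norm x')\<^sup>2) * (\<mu> (Some y) * (1 - (norm y')\<^sup>2))"
    by simp
  moreover have "(norm (x - y))\<^sup>2 = \<mu> (Some x) * \<mu> (Some y) * (norm (x' - y'))\<^sup>2"
    using form[of "Some x" "Some y"] by (simp add: x' y' lorentz_form_null_vectors
        del: null_vector.simps)
  ultimately have "(norm (x - y))\<^sup>2 * ((1 - (norm x')\<^sup>2) * (1 - (norm y')\<^sup>2)) =
      4 * (x $ k * y $ k) * (norm (x' - y'))\<^sup>2"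
    by algebra
  then show ?thesis by (rule that[OF x'(1) y'(1) x'(2) y'(2)])
qed

section \<open>The Gromov metric in terms of the hyperbolic distance\<close>

text \<open>
  Here \<open>h\<close> and \<open>l\<close> are the heights of two points at distance \<open>d\<close>, and \<open>s\<close> is \<open>sinh (\<rho> / 2)\<close>. The quotient
  is \<open>2 * s + sqrt (h / l)\<close>, and \<open>h - l \<le> d\<close> bounds \<open>sqrt (h / l)\<close> by \<open>exp (\<rho> / 2) = s + sqrt (s\<^sup>2 + 1)\<close>, with
  equality on vertical lines.
\<close>

lemma half_space_quotient_bounds:
  fixes d h l s :: real
  assumes l: "0 < l" "l \<le> h" and d: "h - l \<le> d" and s: "s = d / (2 * sqrt (h * l))"
  shows "2 * s + 1 \<le> (d + h) / sqrt (h * l)"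
    and "(d + h) / sqrt (h * l) \<le> 3 * s + sqrt (s\<^sup>2 + 1)"
proof -
  define R where "R = sqrt (h * l)"
  have R: "R > 0" "R\<^sup>2 = h * l" using l by (auto simp: R_def)
  have sR: "d = 2 * s * R" using R s by (simp add: R_def[symmetric])
  have "R\<^sup>2 \<le> h\<^sup>2"
    using R l by (simp add: power2_eq_square mult_left_mono)
  then have "R \<le> h" using l by (auto intro: power2_le_imp_le)
  then show "2 * s + 1 \<le> (d + h) / sqrt (h * l)"
    using R by (simp add: R_def[symmetric] sR field_simps)
  have "h * (h - l) \<le> h * d" using l d by (intro mult_left_mono) auto
  then have "h\<^sup>2 - h * d \<le> R\<^sup>2"
    unfolding R(2) by (simp add: power2_eq_square algebra_simps)
  then have "(h - s * R)\<^sup>2 \<le> (s\<^sup>2 + 1) * R\<^sup>2"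
    by (simp add: sR power2_eq_square algebra_simps)
  then have "h - s * R \<le> sqrt (s\<^sup>2 + 1) * R"
    using real_le_rsqrt[of "h - s * R" "(s\<^sup>2 + 1) * R\<^sup>2"] R(1) by (simp add: real_sqrt_mult)
  then show "(d + h) / sqrt (h * l) \<le> 3 * s + sqrt (s\<^sup>2 + 1)"
    using R by (simp add: R_def[symmetric] sR field_simps)
qed

text \<open>
  Here \<open>m\<close> and \<open>M\<close> are the moduli of two points at distance \<open>D\<close>, and \<open>s\<close> is \<open>sinh (\<rho> / 2)\<close>; the hypothesis on
  \<open>D\<close> is the triangle inequality with the origin. Multiplication by the common denominator \<open>W\<close>
  turns \<open>sqrt (s\<^sup>2 + 1)\<close> into \<open>sqrt (D\<^sup>2 + W\<^sup>2)\<close>, a convex function of \<open>D\<close> that takes the values \<open>1 - m * M\<close>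
  and \<open>1 + m * M\<close> at the extreme distances \<open>M - m\<close> and \<open>M + m\<close>. Replacing it by its chord makes the first
  inequality linear in \<open>D\<close>.
\<close>

lemma ball_quotient_bounds:
  fixes D m M s :: real
  assumes m: "0 \<le> m" "m \<le> M" "M < 1" and D: "\<bar>M - D\<bar> \<le> m"
    and s: "s = D / sqrt ((1 - m\<^sup>2) * (1 - M\<^sup>2))"
  shows "3 * s + sqrt (s\<^sup>2 + 1) \<le> 2 * ((D + (1 - m)) / sqrt ((1 - m) * (1 - M)))"
    and "(D + (1 - m)) / sqrt ((1 - m) * (1 - M)) \<le> 2 * (2 * s + 1)"
proof -
  define W where "W = sqrt ((1 - m\<^sup>2) * (1 - M\<^sup>2))"
  define P where "P = sqrt ((1 + m) * (1 + M))"
  define S where "S = sqrt ((1 - m) * (1 - M))"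
  have M1: "m\<^sup>2 < 1" "M\<^sup>2 < 1"
    using m by (auto simp: abs_square_less_1)
  have D0: "D \<ge> 0" using m D by linarith
  have S: "S > 0" using m by (simp add: S_def)
  have W: "W > 0" "W\<^sup>2 = (1 - m\<^sup>2) * (1 - M\<^sup>2)" using M1 by (auto simp: W_def)
  have "W = P * S"
    by (simp add: W_def P_def S_def real_sqrt_mult[symmetric] power2_eq_square algebra_simps)
  then have quotient: "(D + (1 - m)) / S = (D + (1 - m)) * P / W"
    using S W by auto
  have P: "1 + m \<le> P" "P \<le> 1 + M"
    unfolding P_def using m
    by (auto intro!: real_le_rsqrt real_le_lsqrt simp: power2_eq_square mult_left_mono mult_right_mono)
  have sW: "s = D / W" by (simp add: s W_def)
  have cosh: "sqrt (s\<^sup>2 + 1) = sqrt (D\<^sup>2 + W\<^sup>2) / W"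
  proof -
    have "s\<^sup>2 + 1 = (D\<^sup>2 + W\<^sup>2) / W\<^sup>2"
      using W(1) by (simp add: sW field_simps)
    then show ?thesis using W(1) by (simp add: real_sqrt_divide)
  qed
  \<comment> \<open>The right-hand side is the chord over the interval from \<open>M - m\<close> to \<open>M + m\<close>.\<close>
  have sqrt_le: "sqrt (D\<^sup>2 + W\<^sup>2) \<le> 1 + M * D - M\<^sup>2"
  proof (rule real_le_lsqrt)
    show "0 \<le> 1 + M * D - M\<^sup>2"
      using M1 m D0 mult_nonneg_nonneg[of M D] by linarith
    have "(M - D)\<^sup>2 \<le> m\<^sup>2"
      using D m by (simp add: abs_le_square_iff[symmetric])
    then have "0 \<le> (1 - M\<^sup>2) * (m\<^sup>2 - (M - D)\<^sup>2)"
      using M1 by simp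
    also have "\<dots> = (1 + M * D - M\<^sup>2)\<^sup>2 - (D\<^sup>2 + W\<^sup>2)"
      unfolding W by algebra
    finally show "D\<^sup>2 + W\<^sup>2 \<le> (1 + M * D - M\<^sup>2)\<^sup>2" by simp
  qed
  have "3 * D + (1 + M * D - M\<^sup>2) \<le> 2 * (D + (1 - m)) * (1 + m)"
  proof -
    \<comment> \<open>The difference of the two sides, expanded around the worst case \<open>D = M + m\<close>.\<close>
    have "0 \<le> (1 - m) * (1 - M) + (1 - 2 * m + M) * (M + m - D)"
      using m D by (intro add_nonneg_nonneg[OF mult_nonneg_nonneg mult_nonneg_nonneg]) linarith+
    then show ?thesis by (simp add: power2_eq_square algebra_simps)
  qed
  also have "\<dots> \<le> 2 * (D + (1 - m)) * P"
    using P m D0 by (intro mult_left_mono) auto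
  finally have "3 * D + sqrt (D\<^sup>2 + W\<^sup>2) \<le> 2 * ((D + (1 - m)) * P)"
    using sqrt_le by (simp only: mult.assoc)
  then have "(3 * D + sqrt (D\<^sup>2 + W\<^sup>2)) / W \<le> 2 * ((D + (1 - m)) * P) / W"
    using W by (intro divide_right_mono) auto
  then show "3 * s + sqrt (s\<^sup>2 + 1) \<le> 2 * ((D + (1 - m)) / sqrt ((1 - m) * (1 - M)))"
    unfolding S_def[symmetric] quotient cosh by (simp add: sW add_divide_distrib)
  have "1 - m * M \<le> D + W"
  proof (rule power2_le_imp_le)
    have "(M - m)\<^sup>2 \<le> D\<^sup>2"
      using D m by (intro power_mono) auto
    moreover have "(1 - m * M)\<^sup>2 = (M - m)\<^sup>2 + W\<^sup>2"
      unfolding W by algebra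
    moreover have "D\<^sup>2 + W\<^sup>2 \<le> (D + W)\<^sup>2"
      using D0 W by (simp add: power2_sum)
    ultimately show "(1 - m * M)\<^sup>2 \<le> (D + W)\<^sup>2" by linarith
  qed (use D0 W in auto)
  moreover have "(D + (1 - m)) * P \<le> (D + (1 - m)) * (1 + M)"
    using P m D0 by (intro mult_left_mono) auto
  moreover have "D * M \<le> D * 1"
    using m D0 by (intro mult_left_mono) auto
  moreover have "(D + (1 - m)) * (1 + M) = D + D * M + (1 - m * M) + (M - m)"
    by algebra
  moreover have "M - m \<le> D" using D by linarith
  ultimately have "(D + (1 - m)) * P \<le> 2 * (2 * D + W)"
    using W(1) unfolding mult_1_right by argo
  then have "(D + (1 - m)) * P / W \<le> 2 * (2 * D + W) / W"
    using W by (intro divide_right_mono) auto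
  then show "(D + (1 - m)) / sqrt ((1 - m) * (1 - M)) \<le> 2 * (2 * s + 1)"
    unfolding S_def[symmetric] quotient using W by (simp add: sW add_divide_distrib)
qed

section \<open>Boundary distances\<close>

lemma norm_axis: "norm (axis k a :: real ^ 'n) = \<bar>a\<bar>"
  by (simp add: norm_eq_sqrt_inner inner_axis_axis)

lemma boundary_dist_upper_half_space:
  assumes "x \<in> upper_half_space k"
  shows "boundary_dist (upper_half_space k) x = x $ k"
proof -
  have "upper_half_space k = {x. axis k 1 \<bullet> x > 0}"
    by (simp add: upper_half_space_def inner_axis')
  then have fr: "frontier (upper_half_space k) = {x. x $ k = 0}"
    using frontier_halfspace_gt[of "axis k (1::real)" 0] by (simp add: inner_axis')
  have xk: "norm (axis k (x $ k)) = x $ k"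
    using assms by (simp add: norm_axis upper_half_space_def)
  have "infdist x {x. x $ k = 0} \<le> dist x (x - axis k (x $ k))"
    by (rule infdist_le) (simp add: axis_def)
  also have "\<dots> = x $ k"
    by (simp add: dist_norm xk)
  finally have "infdist x {x. x $ k = 0} \<le> x $ k" .
  moreover have "x $ k \<le> infdist x {x. x $ k = 0}"
  proof -
    have ne: "{x::real^'a. x $ k = 0} \<noteq> {}"
      by (auto intro: exI[of _ 0])
    show ?thesis
      unfolding infdist_notempty[OF ne]
    proof (rule cINF_greatest[OF ne])
      fix y :: "real ^ 'a" assume "y \<in> {x. x $ k = 0}"
      then show "x $ k \<le> dist x y"
        using component_le_norm_cart[of "x - y" k] by (simp add: dist_norm)
    qed
  qed
  ultimately show ?thesis
    by (simp add: boundary_dist_def fr)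
qed

lemma boundary_dist_unit_ball:
  fixes x :: "'a::euclidean_space"
  assumes x: "norm x < 1"
  shows "boundary_dist (ball 0 1) x = 1 - norm x"
proof -
  \<comment> \<open>The radial direction of \<open>x\<close>; at the origin every direction leads to a nearest boundary point.\<close>
  define u :: 'a where "u = (if x = 0 then SOME i. i \<in> Basis else x /\<^sub>R norm x)"
  have u: "norm u = 1" "x = norm x *\<^sub>R u"
    by (auto simp: u_def some_in_eq nonempty_Basis)
  then have ne: "sphere (0::'a) 1 \<noteq> {}" by auto
  have "infdist x (sphere 0 1) \<le> dist u x"
    using u by (subst dist_commute) (rule infdist_le, simp)
  also have "dist u x = norm ((1 - norm x) *\<^sub>R u)"
    using u(2) by (simp add: dist_norm scaleR_diff_left)
  also have "\<dots> = 1 - norm x"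
    using x u by simp
  finally have "infdist x (sphere 0 1) \<le> 1 - norm x" .
  moreover have "1 - norm x \<le> infdist x (sphere 0 1)"
    unfolding infdist_notempty[OF ne]
  proof (rule cINF_greatest[OF ne])
    fix y :: 'a assume "y \<in> sphere 0 1"
    then show "1 - norm x \<le> dist x y"
      using norm_triangle_sub[of y x] by (simp add: dist_norm norm_minus_commute)
  qed
  ultimately show ?thesis
    by (simp add: boundary_dist_def)
qed

section \<open>Sharpness\<close>

text \<open>
  The inversion in the sphere of radius \<open>sqrt 2\<close> about \<open>- axis k 1\<close> fixes the unit sphere of the hyperplane
  \<open>x $ k = 0\<close> pointwise; it exchanges the upper half-space and the unit ball.
\<close>

definition cayley :: "'n::finite \<Rightarrow> (real ^ 'n) option \<Rightarrow> (real ^ 'n) option" where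
  "cayley k = sphere_reflection (- axis k 1) (sqrt 2)"

lemma cayley_Some:
  assumes "x \<noteq> - axis k 1"
  shows "cayley k (Some x) = Some (- axis k 1 + (2 / (norm (x + axis k 1))\<^sup>2) *\<^sub>R (x + axis k 1))"
  using assms by (simp add: cayley_def power_divide)

lemma norm_add_axis_square: "(norm (x + axis k 1))\<^sup>2 = (norm x)\<^sup>2 + 2 * x $ k + 1"
  for x :: "real ^ 'n"
  by (simp add: power2_norm_eq_inner inner_add inner_axis inner_axis' inner_axis_axis)

lemma half_space_to_ball_cayley: "half_space_to_ball k (cayley k)"
proof -
  let ?e = "axis k 1 :: real ^ 'a"
  have "moebius_transformation (cayley k \<circ> id)"
    unfolding cayley_def by (intro moebius_transformation.intros) auto
  moreover have "cayley k (Some x) \<in> Some ` ball 0 1" if x: "x \<in> upper_half_space k" for x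
  proof -
    have xk: "x $ k > 0" using x by (simp add: upper_half_space_def)
    then have ne: "x \<noteq> - ?e" by (auto simp: axis_def)
    define d where "d = (norm (x + ?e))\<^sup>2"
    have d: "d > 0" using ne by (simp add: d_def add_eq_0_iff2)
    define y where "y = - ?e + (2 / d) *\<^sub>R (x + ?e)"
    have "(norm y)\<^sup>2 = ?e \<bullet> ?e - 4 / d * ((x + ?e) \<bullet> ?e) + (2 / d)\<^sup>2 * ((x + ?e) \<bullet> (x + ?e))"
      unfolding y_def power2_norm_eq_inner inner_add_left[of "- ?e"] inner_add_right[of _ "- ?e"]
        inner_scaleR_left inner_scaleR_right inner_minus_left inner_minus_right
        inner_commute[of ?e "x + ?e"]
      by algebra
    also have "\<dots> = 1 - 4 / d * (x $ k + 1) + (2 / d)\<^sup>2 * d"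
      by (simp add: d_def power2_norm_eq_inner inner_add_left inner_axis inner_axis_axis)
    also have "\<dots> = 1 - 4 * x $ k / d"
      using d by (simp add: field_simps power2_eq_square)
    also have "\<dots> < 1" using d xk by simp
    finally have "norm y < 1" by (simp add: abs_square_less_1)
    then show ?thesis
      using cayley_Some[OF ne] by (simp add: y_def d_def)
  qed
  moreover have "Some y \<in> cayley k ` Some ` upper_half_space k" if y: "norm y < 1" for y
  proof -
    have ne: "y \<noteq> - ?e" using y by auto
    define d where "d = (norm (y + ?e))\<^sup>2"
    have d: "d > 0" using ne by (simp add: d_def add_eq_0_iff2)
    define x where "x = - ?e + (2 / d) *\<^sub>R (y + ?e)"
    have xe: "x + ?e = (2 / d) *\<^sub>R (y + ?e)"
      by (simp add: x_def)
    have "d < 2 * (y $ k + 1)"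
      using y norm_add_axis_square[of y k] abs_square_less_1[of "norm y"] by (simp add: d_def)
    then have "x $ k > 0"
      using d by (simp add: x_def axis_def field_simps)
    then have x: "x \<in> upper_half_space k" and ne': "x \<noteq> - ?e"
      by (auto simp: upper_half_space_def axis_def)
    have "(norm (x + ?e))\<^sup>2 = 4 / d"
      unfolding xe using d by (simp add: d_def[symmetric] power_mult_distrib power2_eq_square power_divide)
        (simp add: d_def power2_eq_square)
    then have "cayley k (Some x) = Some y"
      using d by (simp add: cayley_Some[OF ne'] xe)
    with x show ?thesis by (metis imageI)
  qed
  ultimately show ?thesis
    unfolding half_space_to_ball_def by auto
qed

text \<open>Heights \<open>a\<close> and \<open>1 / a\<close> are sent to opposite points of the axis, hence to points of equal modulus.\<close>

lemma cayley_axis: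
  assumes "a > 0"
  shows "cayley k (Some (axis k a)) = Some (axis k ((1 - a) / (1 + a)))"
proof -
  have sum: "axis k a + axis k 1 = axis k (a + 1 :: real)"
    by (auto simp: axis_def vec_eq_iff)
  have "axis k a \<noteq> - axis k (1::real)"
    using assms by (auto simp: axis_def vec_eq_iff intro!: exI[of _ k])
  from cayley_Some[OF this]
  have "cayley k (Some (axis k a)) = Some (- axis k 1 + (2 / (a + 1)\<^sup>2) *\<^sub>R axis k (a + 1))"
    by (simp add: sum norm_axis)
  moreover have "2 / (a + 1)\<^sup>2 * (a + 1) - 1 = (1 - a) / (1 + a)"
  proof -
    have "2 / (a + 1)\<^sup>2 * (a + 1) = 2 * (a + 1) / ((a + 1) * (a + 1))"
      by (simp only: power2_eq_square times_divide_eq_left)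
    also have "\<dots> = 2 / (a + 1)"
      using assms by (simp only: mult_divide_mult_cancel_right)
    finally have "2 / (a + 1)\<^sup>2 * (a + 1) = 2 / (a + 1)" .
    then show ?thesis using assms by (simp add: field_simps)
  qed
  then have "- axis k 1 + (2 / (a + 1)\<^sup>2) *\<^sub>R axis k (a + 1) = axis k ((1 - a) / (1 + a))"
    by (auto simp: axis_def vec_eq_iff)
  ultimately show ?thesis by simp
qed

text \<open>The quotients inside the two logarithms are \<open>2 * a - 1 / a\<close> and \<open>a\<close>.\<close>

lemma gromov_metric_deficit_cayley:
  fixes k :: "'n::finite"
  assumes a: "a > 1"
  defines "x \<equiv> axis k a :: real ^ 'n" and "y \<equiv> axis k (1 / a) :: real ^ 'n"
  shows "gromov_metric (upper_half_space k) x y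
      - gromov_metric (ball 0 1) (the (cayley k (Some x))) (the (cayley k (Some y)))
    = 2 * ln (2 - 1 / a\<^sup>2)"
proof -
  have diff: "axis k s - axis k t = (axis k (s - t) :: real ^ 'n)" for s t
    by (auto simp: axis_def vec_eq_iff)
  have "x \<in> upper_half_space k" "y \<in> upper_half_space k"
    using a by (auto simp: x_def y_def upper_half_space_def)
  moreover have "1 / a < a" using a by (simp add: field_simps less_1_mult)
  ultimately have H: "gromov_metric (upper_half_space k) x y = 2 * ln (2 * a - 1 / a)"
    using a unfolding gromov_metric_def
    by (simp add: boundary_dist_upper_half_space) (simp add: x_def y_def diff norm_axis)
  define m where "m = (a - 1) / (a + 1)"
  have m: "0 < m" "m < 1" "1 + m = a * (1 - m)"
    using a by (auto simp: m_def field_simps)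
  have im: "the (cayley k (Some x)) = axis k (- m)" "the (cayley k (Some y)) = axis k m"
  proof -
    have "(1 - a) / (1 + a) = - m"
      using a by (simp add: m_def field_simps)
    moreover have "1 - 1 / a = (a - 1) / a" "1 + 1 / a = (a + 1) / a"
      using a by (auto simp: field_simps)
    then have "(1 - 1 / a) / (1 + 1 / a) = m"
      using a by (simp add: m_def)
    ultimately
    show "the (cayley k (Some x)) = axis k (- m)" "the (cayley k (Some y)) = axis k m"
      using a by (simp_all only: x_def y_def cayley_axis option.sel zero_less_divide_1_iff)
  qed
  have "(2 * m + (1 - m)) / sqrt ((1 - m) * (1 - m)) = a"
    unfolding real_sqrt_abs2 using m by (simp add: field_simps)
  then have "gromov_metric (ball 0 1) (axis k (- m) :: real ^ 'n) (axis k m) = 2 * ln a"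
    using m unfolding gromov_metric_def by (simp add: boundary_dist_unit_ball diff norm_axis)
  moreover have "2 * a - 1 / a = a * (2 - 1 / a\<^sup>2)"
    using a by (simp add: field_simps power2_eq_square)
  moreover have "1 / a\<^sup>2 < 1" using a by simp
  then have "ln (a * (2 - 1 / a\<^sup>2)) = ln a + ln (2 - 1 / a\<^sup>2)"
    using a by (intro ln_mult_pos) linarith+
  ultimately show ?thesis
    unfolding H im by simp
qed

section \<open>The distortion theorem\<close>

lemma gromov_metric_half_space_ball_bounds:
  fixes k :: "'n::finite" and x y :: "real ^ 'n"
  assumes card: "CARD('n) \<ge> 2" and f: "half_space_to_ball k f"
    and x: "x \<in> upper_half_space k" and y: "y \<in> upper_half_space k"
  shows "gromov_metric (upper_half_space k) x y - 2 * ln 2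
      \<le> gromov_metric (ball 0 1) (the (f (Some x))) (the (f (Some y)))"
    and "gromov_metric (ball 0 1) (the (f (Some x))) (the (f (Some y)))
      \<le> gromov_metric (upper_half_space k) x y + 2 * ln 2"
proof -
  obtain x' y' where f': "f (Some x) = Some x'" "f (Some y) = Some y'"
    and norms: "norm x' < 1" "norm y' < 1"
    and inv: "(norm (x - y))\<^sup>2 * ((1 - (norm x')\<^sup>2) * (1 - (norm y')\<^sup>2)) =
      4 * (x $ k * y $ k) * (norm (x' - y'))\<^sup>2"
    using half_space_to_ball_sinh_invariant[OF card f x y] .
  define d where "d = norm (x - y)"
  define D where "D = norm (x' - y')"
  define h where "h = max (x $ k) (y $ k)"
  define l where "l = min (x $ k) (y $ k)"
  define m where "m = min (norm x') (norm y')"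
  define M where "M = max (norm x') (norm y')"
  have xy: "x $ k > 0" "y $ k > 0"
    using x y by (auto simp: upper_half_space_def)
  have l: "0 < l" "l \<le> h" and hl: "x $ k * y $ k = h * l"
    using xy by (auto simp: l_def h_def min_def max_def)
  have hd: "h - l \<le> d"
    using component_le_norm_cart[of "x - y" k] by (auto simp: l_def h_def d_def min_def max_def)
  have m: "0 \<le> m" "m \<le> M" "M < 1"
    using norms by (auto simp: m_def M_def)
  have mM: "(1 - norm x') * (1 - norm y') = (1 - m) * (1 - M)"
    "(1 - (norm x')\<^sup>2) * (1 - (norm y')\<^sup>2) = (1 - m\<^sup>2) * (1 - M\<^sup>2)"
    "max (1 - norm x') (1 - norm y') = 1 - m"
    by (auto simp: m_def M_def min_def max_def)
  have D: "\<bar>M - D\<bar> \<le> m"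
    using norm_triangle_ineq3[of x' y'] norm_triangle_ineq4[of x' y']
      norm_triangle_sub[of x' y'] norm_triangle_sub[of y' x']
    by (auto simp: D_def m_def M_def min_def max_def norm_minus_commute abs_if)
  have M1: "(1 - m\<^sup>2) * (1 - M\<^sup>2) > 0"
    using m by (auto simp: abs_square_less_1 intro!: mult_pos_pos)
  define s where "s = d / (2 * sqrt (h * l))"
  have "s\<^sup>2 = (D / sqrt ((1 - m\<^sup>2) * (1 - M\<^sup>2)))\<^sup>2"
    using inv l M1 unfolding s_def hl mM d_def[symmetric] D_def[symmetric]
    by (simp add: power_divide power_mult_distrib field_simps)
  then have s: "s = D / sqrt ((1 - m\<^sup>2) * (1 - M\<^sup>2))"
    by (rule power2_eq_imp_eq) (use l M1 in \<open>auto simp: s_def d_def D_def\<close>)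
  define EH where "EH = (d + h) / sqrt (h * l)"
  define EB where "EB = (D + (1 - m)) / sqrt ((1 - m) * (1 - M))"
  have gH: "gromov_metric (upper_half_space k) x y = 2 * ln EH"
    by (simp add: gromov_metric_def boundary_dist_upper_half_space x y EH_def d_def hl h_def[symmetric])
  have gB: "gromov_metric (ball 0 1) (the (f (Some x))) (the (f (Some y))) = 2 * ln EB"
    by (simp add: gromov_metric_def boundary_dist_unit_ball norms f' EB_def D_def mM)
  have "s \<ge> 0" using l by (simp add: s_def d_def)
  note H = half_space_quotient_bounds[OF l hd s_def, folded EH_def]
  note B = ball_quotient_bounds[OF m D s, folded EB_def]
  have "EH > 0" using H(1) \<open>s \<ge> 0\<close> by linarith
  have "EH \<le> 2 * EB" using H(2) B(1) by (rule order_trans)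
  have "EB \<le> 2 * EH" using H(1) B(2) by argo
  then have "EB > 0" using \<open>EH \<le> 2 * EB\<close> \<open>EH > 0\<close> by linarith
  have "ln EH \<le> ln 2 + ln EB"
    using \<open>EH \<le> 2 * EB\<close> \<open>EH > 0\<close> \<open>EB > 0\<close> by (simp flip: ln_mult_pos)
  then show "gromov_metric (upper_half_space k) x y - 2 * ln 2
      \<le> gromov_metric (ball 0 1) (the (f (Some x))) (the (f (Some y)))"
    unfolding gH gB by simp
  have "ln EB \<le> ln 2 + ln EH"
    using \<open>EB \<le> 2 * EH\<close> \<open>EH > 0\<close> \<open>EB > 0\<close> by (simp flip: ln_mult_pos)
  then show "gromov_metric (ball 0 1) (the (f (Some x))) (the (f (Some y)))
      \<le> gromov_metric (upper_half_space k) x y + 2 * ln 2"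
    unfolding gH gB by simp
qed

lemma gromov_metric_lower_constant_sharp:
  fixes k :: "'n::finite"
  assumes c: "c < 2 * ln 2"
  obtains f x y where "half_space_to_ball k f" "x \<in> upper_half_space k" "y \<in> upper_half_space k"
    "gromov_metric (ball 0 1) (the (f (Some x))) (the (f (Some y)))
      < gromov_metric (upper_half_space k) x y - c"
proof -
  have "exp (c / 2) < exp (ln 2)" using c by (subst exp_less_cancel_iff) simp
  then have "max 1 (exp (c / 2)) < 2" by simp
  then obtain q where q: "max 1 (exp (c / 2)) < q" "q < 2"
    using dense by blast
  \<comment> \<open>The solution of \<open>2 - 1 / a\<^sup>2 = q\<close>, which turns the deficit into \<open>2 * ln q\<close>.\<close>
  define a where "a = 1 / sqrt (2 - q)"
  have a: "a > 1" "2 - 1 / a\<^sup>2 = q"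
    using q by (auto simp: a_def power_divide)
  have "ln (exp (c / 2)) < ln q" using q by (subst ln_less_cancel_iff) auto
  then have "c < 2 * ln q" by simp
  then show ?thesis
    using gromov_metric_deficit_cayley[OF a(1), of k] a
    by (intro that[of "cayley k" "axis k a" "axis k (1 / a)"])
      (auto simp: half_space_to_ball_cayley upper_half_space_def)
qed

theorem theorem6p6:
  fixes k :: "'n::finite"
  assumes "CARD('n) \<ge> 2"
  shows "(\<forall>f. half_space_to_ball k f \<longrightarrow>
            (\<forall>x\<in>upper_half_space k. \<forall>y\<in>upper_half_space k.
               gromov_metric (upper_half_space k) x y - 2 * ln 2
                 \<le> gromov_metric (ball 0 1) (the (f (Some x))) (the (f (Some y))) \<and>
               gromov_metric (ball 0 1) (the (f (Some x))) (the (f (Some y)))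
                 \<le> gromov_metric (upper_half_space k) x y + 2 * ln 2))
       \<and> (\<forall>c < 2 * ln 2.
            \<not> (\<forall>f. half_space_to_ball k f \<longrightarrow>
                 (\<forall>x\<in>upper_half_space k. \<forall>y\<in>upper_half_space k.
                    gromov_metric (upper_half_space k) x y - c
                      \<le> gromov_metric (ball 0 1) (the (f (Some x))) (the (f (Some y))))))"
proof (intro conjI allI impI ballI notI)
  fix c :: real
  assume c: "c < 2 * ln 2"
    and *: "\<forall>f. half_space_to_ball k f \<longrightarrow>
                 (\<forall>x\<in>upper_half_space k. \<forall>y\<in>upper_half_space k.
                    gromov_metric (upper_half_space k) x y - c
                      \<le> gromov_metric (ball 0 1) (the (f (Some x))) (the (f (Some y))))"
  from gromov_metric_lower_constant_sharp[OF c, of k] * show False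
    by (metis not_less)
qed (use gromov_metric_half_space_ball_bounds[OF assms] in auto)

end
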